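(* For every integer $n\geq 4$, $\mathcal{K}_n\supseteq\mathcal{K}_{n+1}$.
   Context: All matroids are finite. For a matroid $M$ with rank function $r$ and ground set $E(M)$, and an integer $n\geq 4$, the $n$-th Kinser inequality for a family $X_1,\dots,X_n$ of subsets of $E(M)$ is $$\sum_{i=3}^n r(X_i)+r(X_1\cup X_2)+r(X_1\cup X_3\cup X_n)+\sum_{i=4}^n r(X_2\cup X_{i-1}\cup X_i)\leq r(X_1\cup X_3)+r(X_1\cup X_n)+\sum_{i=3}^n r(X_2\cup X_i)+\sum_{i=4}^n r(X_{i-1}\cup X_i).$$ $\mathcal{K}_n$ is the class of matroids $M$ that satisfy the $n$-th Kinser inequality for all families $X_1,\dots,X_n$ of subsets of $E(M)$. *)

theory Defs imports Main begin

locale matroid =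
  fixes E :: "'a set" and I :: "'a set set"
  assumes finite_ground: "finite E"
    and indep_subset_ground: "J \<in> I \<Longrightarrow> J \<subseteq> E"
    and empty_indep: "{} \<in> I"
    and indep_subset: "J \<in> I \<Longrightarrow> K \<subseteq> J \<Longrightarrow> K \<in> I"
    and augmentation:
      "J \<in> I \<Longrightarrow> K \<in> I \<Longrightarrow> card J < card K \<Longrightarrow> \<exists>x \<in> K - J. insert x J \<in> I"

definition matroid_rank :: "'a set set \<Rightarrow> 'a set \<Rightarrow> nat" where
  "matroid_rank I X = Max (card ` {J \<in> I. J \<subseteq> X})"

text \<open>Families \<open>X\<^sub>1, \<dots>, X\<^sub>n\<close> are functions on \<open>nat\<close> of which only the values
  at \<open>1, \<dots>, n\<close> matter.  The inequality is meant for \<open>n \<ge> 4\<close>.\<close>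

definition kinser_inequality ::
  "('a set \<Rightarrow> nat) \<Rightarrow> nat \<Rightarrow> (nat \<Rightarrow> 'a set) \<Rightarrow> bool" where
  "kinser_inequality r n X \<longleftrightarrow>
     (\<Sum>i=3..n. r (X i)) + r (X 1 \<union> X 2) + r (X 1 \<union> X 3 \<union> X n)
       + (\<Sum>i=4..n. r (X 2 \<union> X (i - 1) \<union> X i))
     \<le> r (X 1 \<union> X 3) + r (X 1 \<union> X n) + (\<Sum>i=3..n. r (X 2 \<union> X i))
       + (\<Sum>i=4..n. r (X (i - 1) \<union> X i))"

definition kinser_class :: "nat \<Rightarrow> ('a set \<times> 'a set set) set" where
  "kinser_class n = {(E, I). matroid E I \<and>
     (\<forall>X. (\<forall>i \<in> {1..n}. X i \<subseteq> E) \<longrightarrow> kinser_inequality (matroid_rank I) n X)}"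

end

theory Submission imports Defs begin

text \<open>Repeating the last set of a family \<open>X\<^sub>1, \<dots>, X\<^sub>n\<close>, that is, putting
  \<open>X\<^bsub>n+1\<^esub> = X\<^sub>n\<close>, turns the inequality with index \<open>n + 1\<close> into the one with index \<open>n\<close>:
  the terms of index \<open>n + 1\<close> add \<open>r (X\<^sub>n) + r (X\<^sub>2 \<union> X\<^sub>n)\<close> to both sides, and the remaining
  terms that mention \<open>X\<^bsub>n+1\<^esub>\<close> are \<open>r (X\<^sub>1 \<union> X\<^sub>3 \<union> X\<^sub>n)\<close> and \<open>r (X\<^sub>1 \<union> X\<^sub>n)\<close>, which are
  unchanged.  So every instance of the \<open>n\<close>-th inequality is an instance of its successor.\<close>

lemma kinser_inequality_repeat_last:
  assumes "n \<ge> 4"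
  shows "kinser_inequality r (n + 1) (X(n + 1 := X n)) \<longleftrightarrow> kinser_inequality r n X"
proof -
  let ?Y = "X(n + 1 := X n)"
  have "(\<Sum>i=3..n. r (?Y i)) = (\<Sum>i=3..n. r (X i))"
    and "(\<Sum>i=4..n. r (?Y 2 \<union> ?Y (i - 1) \<union> ?Y i)) = (\<Sum>i=4..n. r (X 2 \<union> X (i - 1) \<union> X i))"
    and "(\<Sum>i=3..n. r (?Y 2 \<union> ?Y i)) = (\<Sum>i=3..n. r (X 2 \<union> X i))"
    and "(\<Sum>i=4..n. r (?Y (i - 1) \<union> ?Y i)) = (\<Sum>i=4..n. r (X (i - 1) \<union> X i))"
    using assms by (intro sum.cong; auto)+
  moreover have "?Y 1 = X 1" "?Y 2 = X 2" "?Y 3 = X 3" "?Y n = X n" "?Y (n + 1) = X n"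
    using assms by auto
  ultimately show ?thesis
    using assms unfolding kinser_inequality_def
    by (simp add: Un_assoc add.assoc del: fun_upd_apply)
qed

theorem lemma4p2:
  fixes n :: nat
  assumes "n \<ge> 4"
  shows "(kinser_class n :: ('a set \<times> 'a set set) set) \<supseteq> kinser_class (n + 1)"
proof
  fix M :: "'a set \<times> 'a set set"
  assume M: "M \<in> kinser_class (n + 1)"
  obtain E I where EI: "M = (E, I)" by (cases M)
  have "kinser_inequality (matroid_rank I) n X" if X: "\<forall>i\<in>{1..n}. X i \<subseteq> E" for X
  proof -
    have "\<forall>i\<in>{1..n + 1}. (X(n + 1 := X n)) i \<subseteq> E"
      using X assms by auto
    then have "kinser_inequality (matroid_rank I) (n + 1) (X(n + 1 := X n))"
      using M unfolding EI kinser_class_def by blast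
    then show ?thesis
      using kinser_inequality_repeat_last[OF assms] by blast
  qed
  then show "M \<in> kinser_class n"
    using M unfolding EI kinser_class_def by blast
qed

end
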